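(* Let $G=(V(G),A(G))$ be a weakly connected digraph with $\delta^+(G)\geq 2$ and $\delta^-(G)\geq 1$. Then $Z(L(G))=|A(G)|-|V(G)|$.
   Context: A digraph $G$ has a finite non-empty vertex set $V(G)$ and a set $A(G)\subseteq V(G)\times V(G)$ of arcs; loops $(u,u)$ are allowed. $N^+_G(v)=\{u:(v,u)\in A(G)\}$, $N^-_G(v)=\{w:(w,v)\in A(G)\}$, $d^\pm_G(v)=|N^\pm_G(v)|$; $\delta^\pm(G)$ is the minimum of $d^\pm_G(v)$ over $v\in V(G)$. $G$ is weakly connected if its underlying undirected graph is connected. Line digraph: $L(G)$ has vertex set $\{uv:(u,v)\in A(G)\}$, with an arc from $uv$ to $xy$ exactly when $v=x$. Zero forcing in a digraph $H$: for non-empty $S\subseteq V(H)$ put $B^0(S)=S$ and, for $i\ge 0$: if $H$ has no loops, $B^{i+1}(S)=B^i(S)\cup\{v\in V(H)\setminus B^i(S):\exists u\in B^i(S),\ N^+_H(u)\setminus B^i(S)=\{v\}\}$; if $H$ has at least one loop, $B^{i+1}(S)=B^i(S)\cup\{v\in V(H)\setminus B^i(S):\exists u\in V(H),\ N^+_H(u)\setminus B^i(S)=\{v\}\}$. $S$ is a zero forcing set if $B^m(S)=V(H)$ for some $m\ge 0$. $Z(H)$ is the minimum cardinality of a zero forcing set of $H$. *)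

theory Defs
  imports "Graph_Theory.Digraph_Component"
begin

text \<open>
  Digraphs are the \<^term>\<open>pair_fin_digraph\<close>s of the library: finitely many vertices, arcs are
  ordered pairs of vertices, loops are allowed. Non-emptiness of the vertex set is not part of
  that locale; it is part of the library's \<^const>\<open>Digraph_Component.connected\<close>, which is weak
  connectedness (any two vertices are joined by a walk in the symmetric closure of the arcs).
\<close>

definition out_nbrs :: "'a pair_pre_digraph \<Rightarrow> 'a \<Rightarrow> 'a set" where
  "out_nbrs G v = {u. (v, u) \<in> parcs G}"

definition in_nbrs :: "'a pair_pre_digraph \<Rightarrow> 'a \<Rightarrow> 'a set" where
  "in_nbrs G v = {w. (w, v) \<in> parcs G}"

text \<open>The library's degrees count arcs; here they agree with the numbers of neighbours.\<close>

lemma out_degree_eq_card_out_nbrs: "out_degree (with_proj G) v = card (out_nbrs G v)"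
proof -
  have "out_arcs (with_proj G) v = Pair v ` out_nbrs G v"
    by (auto simp: out_arcs_def out_nbrs_def)
  then show ?thesis
    by (simp add: out_degree_def card_image inj_on_def)
qed

lemma in_degree_eq_card_in_nbrs: "in_degree (with_proj G) v = card (in_nbrs G v)"
proof -
  have "in_arcs (with_proj G) v = (\<lambda>w. (w, v)) ` in_nbrs G v"
    by (auto simp: in_arcs_def in_nbrs_def)
  then show ?thesis
    by (simp add: in_degree_def card_image inj_on_def)
qed

definition min_out_degree :: "'a pair_pre_digraph \<Rightarrow> nat" where
  "min_out_degree G = Min (out_degree (with_proj G) ` pverts G)"

definition min_in_degree :: "'a pair_pre_digraph \<Rightarrow> nat" where
  "min_in_degree G = Min (in_degree (with_proj G) ` pverts G)"

definition line_digraph :: "'a pair_pre_digraph \<Rightarrow> ('a \<times> 'a) pair_pre_digraph" where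
  "line_digraph G =
     \<lparr> pverts = parcs G,
       parcs = {((u, v), (x, y)) | u v x y. (u, v) \<in> parcs G \<and> (x, y) \<in> parcs G \<and> v = x} \<rparr>"

lemma (in pair_fin_digraph) pair_fin_digraph_line_digraph: "pair_fin_digraph (line_digraph G)"
proof
  have "parcs (line_digraph G) \<subseteq> parcs G \<times> parcs G"
    by (auto simp: line_digraph_def)
  then show "finite (parcs (line_digraph G))"
    using pair_finite_arcs by (blast intro: finite_subset)
qed (use pair_finite_arcs in \<open>auto simp: line_digraph_def\<close>)

definition has_loop :: "'a pair_pre_digraph \<Rightarrow> bool" where
  "has_loop H \<longleftrightarrow> (\<exists>u\<in>pverts H. (u, u) \<in> parcs H)"

text \<open>
  In a loopless digraph only blue vertices (those in \<open>B\<close>) may force; as soon as the digraph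
  has a loop, every vertex may force.
\<close>

definition zf_step :: "'a pair_pre_digraph \<Rightarrow> 'a set \<Rightarrow> 'a set" where
  "zf_step H B =
     (if has_loop H
      then B \<union> {v \<in> pverts H - B. \<exists>u\<in>pverts H. out_nbrs H u - B = {v}}
      else B \<union> {v \<in> pverts H - B. \<exists>u\<in>B. out_nbrs H u - B = {v}})"

primrec zf_blue :: "'a pair_pre_digraph \<Rightarrow> 'a set \<Rightarrow> nat \<Rightarrow> 'a set" where
  "zf_blue H S 0 = S"
| "zf_blue H S (Suc i) = zf_step H (zf_blue H S i)"

definition zero_forcing_set :: "'a pair_pre_digraph \<Rightarrow> 'a set \<Rightarrow> bool" where
  "zero_forcing_set H S \<longleftrightarrow>
     S \<noteq> {} \<and> S \<subseteq> pverts H \<and> (\<exists>m. zf_blue H S m = pverts H)"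

definition zero_forcing_number :: "'a pair_pre_digraph \<Rightarrow> nat" where
  "zero_forcing_number H = Min (card ` {S. zero_forcing_set H S})"

end

theory Submission
  imports Defs
begin

text \<open>
  In the line digraph the arc \<open>(u, v)\<close> has as out-neighbours all arcs that leave \<open>v\<close>. The
  out-neighbourhoods are therefore the classes of the partition of the arcs of \<open>G\<close> by their tail,
  and each class is seen by the arcs into its tail and by nothing else.

  Two white arcs with the same tail block each other for ever, since whoever sees one of them sees
  the other (\<open>white_twins_stay_white\<close>). So the complement of a zero forcing set contains at most
  one arc per tail, which gives the lower bound.

  For the upper bound, leave exactly one arc \<open>(v, f v)\<close> white for each vertex \<open>v\<close>. If the forcing
  process stalls, let \<open>U\<close> be the set of vertices whose arc is still white. An arc into a vertex
  \<open>v\<close> of \<open>U\<close> cannot be blue, as it would force \<open>(v, f v)\<close>. So the only arcs into \<open>U\<close> are arcs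
  \<open>(w, f w)\<close> with \<open>w\<close> in \<open>U\<close>. Since every vertex has an in-neighbour, each vertex of \<open>U\<close> is
  of the form \<open>f w\<close> with \<open>w\<close> in \<open>U\<close>, and going backwards one finds a cycle of \<open>f\<close> inside \<open>U\<close>,
  unless \<open>U\<close> is empty. Such cycles are avoided by letting \<open>f v\<close> be an out-neighbour
  from which \<open>v\<close> cannot be reached, whenever there is one: a vertex of \<open>U\<close> has a second
  out-neighbour, it lies outside \<open>U\<close>, and no path from outside enters \<open>U\<close>. So \<open>f v\<close> was
  chosen among the out-neighbours that cannot reach \<open>v\<close>, and \<open>v\<close> is on no cycle of \<open>f\<close>
  (\<open>no_stalled_vertices\<close>).
\<close>

section \<open>Zero forcing in general digraphs\<close>

lemma zf_blue_subset_pverts: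
  assumes "S \<subseteq> pverts H"
  shows "zf_blue H S m \<subseteq> pverts H"
  using assms by (induction m) (auto simp: zf_step_def)

lemma subset_zf_blue: "S \<subseteq> zf_blue H S m"
  by (induction m) (auto simp: zf_step_def)

text \<open>
  The blue sets grow inside a finite set, so the process reaches a fixed point. There no blue
  vertex has exactly one white out-neighbour, whichever of the two forcing rules is in use,
  because a blue vertex may force under both. This removes the distinction between digraphs with
  and without loops.
\<close>

lemma zero_forcing_setI:
  assumes fin: "finite (pverts H)" and "S \<noteq> {}" and sub: "S \<subseteq> pverts H"
    and stalled: "\<And>B. \<lbrakk>S \<subseteq> B; B \<subseteq> pverts H;
      \<And>u x. \<lbrakk>u \<in> B; x \<in> pverts H\<rbrakk> \<Longrightarrow> out_nbrs H u - B \<noteq> {x}\<rbrakk> \<Longrightarrow> B = pverts H"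
  shows "zero_forcing_set H S"
proof -
  have "\<forall>m. card (zf_blue H S m) < Suc (card (pverts H))"
    using card_mono[OF fin zf_blue_subset_pverts[OF sub]] by (simp add: less_Suc_eq_le)
  then obtain m where m: "\<And>k. card (zf_blue H S k) \<le> card (zf_blue H S m)"
    using ex_has_greatest_nat[of "\<lambda>_. True" 0 "\<lambda>m. card (zf_blue H S m)"] by (metis less_imp_le)
  define B where "B = zf_blue H S m"
  have B: "S \<subseteq> B" "B \<subseteq> pverts H"
    unfolding B_def by (rule subset_zf_blue, rule zf_blue_subset_pverts[OF sub])
  have "B \<subseteq> zf_step H B"
    by (auto simp: zf_step_def)
  moreover have "finite (zf_step H B)"
    using zf_blue_subset_pverts[OF sub, of "Suc m"] fin by (auto simp: B_def intro: finite_subset)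
  moreover have "card (zf_step H B) \<le> card B"
    using m[of "Suc m"] by (simp add: B_def)
  ultimately have fixpoint: "zf_step H B = B"
    using card_seteq by blast
  have "out_nbrs H u - B \<noteq> {x}" if "u \<in> B" "x \<in> pverts H" for u x
  proof
    assume "out_nbrs H u - B = {x}"
    with that B have "x \<in> zf_step H B" "x \<notin> B"
      by (auto simp: zf_step_def)
    with fixpoint show False by simp
  qed
  then have "B = pverts H"
    using stalled B by blast
  with assms show ?thesis
    unfolding zero_forcing_set_def B_def by blast
qed

text \<open>
  To force one of two vertices, a vertex must see it as its only white out-neighbour; this is
  impossible while a second white vertex has the same in-neighbours.
\<close>

lemma white_twins_stay_white:
  assumes "a \<noteq> b" and twins: "in_nbrs H a = in_nbrs H b"
    and "a \<notin> S" "b \<notin> S"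
  shows "a \<notin> zf_blue H S m \<and> b \<notin> zf_blue H S m"
proof (induction m)
  case 0
  then show ?case using assms by simp
next
  case (Suc m)
  have same: "a \<in> out_nbrs H u \<longleftrightarrow> b \<in> out_nbrs H u" for u
    using twins by (auto simp: in_nbrs_def out_nbrs_def)
  have "out_nbrs H u - zf_blue H S m \<noteq> {a} \<and> out_nbrs H u - zf_blue H S m \<noteq> {b}" for u
    using Suc \<open>a \<noteq> b\<close> same[of u] by (auto simp: set_eq_iff)
  with Suc show ?case
    by (auto simp: zf_step_def)
qed

lemma zero_forcing_number_eqI:
  assumes "finite (pverts H)" and "zero_forcing_set H S"
    and "\<And>T. zero_forcing_set H T \<Longrightarrow> card S \<le> card T"
  shows "zero_forcing_number H = card S"
  unfolding zero_forcing_number_def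
proof (rule Min_eqI)
  have "{T. zero_forcing_set H T} \<subseteq> Pow (pverts H)"
    by (auto simp: zero_forcing_set_def)
  with assms(1) show "finite (card ` {T. zero_forcing_set H T})"
    by (auto intro: finite_subset)
qed (use assms in auto)

section \<open>Zero forcing in line digraphs\<close>

lemma pverts_line_digraph [simp]: "pverts (line_digraph G) = parcs G"
  by (simp add: line_digraph_def)

lemma out_nbrs_line_digraph:
  "(u, v) \<in> parcs G \<Longrightarrow> out_nbrs (line_digraph G) (u, v) = {a \<in> parcs G. fst a = v}"
  by (auto simp: out_nbrs_def line_digraph_def)

lemma in_nbrs_line_digraph:
  "(v, x) \<in> parcs G \<Longrightarrow> in_nbrs (line_digraph G) (v, x) = {a \<in> parcs G. snd a = v}"
  by (auto simp: in_nbrs_def line_digraph_def)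

text \<open>
  Arcs with the same tail are twins in the line digraph, so the arcs outside a zero forcing set
  have distinct tails.
\<close>

lemma (in pair_fin_digraph) card_parcs_le_zero_forcing_set:
  assumes "zero_forcing_set (line_digraph G) S"
  shows "card (parcs G) \<le> card S + card (pverts G)"
proof -
  from assms obtain m where S: "S \<subseteq> parcs G" and m: "zf_blue (line_digraph G) S m = parcs G"
    by (auto simp: zero_forcing_set_def)
  have "inj_on fst (parcs G - S)"
  proof (rule inj_onI, rule ccontr)
    fix a b
    assume ab: "a \<in> parcs G - S" "b \<in> parcs G - S" "fst a = fst b" "a \<noteq> b"
    then have "in_nbrs (line_digraph G) a = in_nbrs (line_digraph G) b"
      by (cases a, cases b) (simp add: in_nbrs_line_digraph)
    with ab have "a \<notin> zf_blue (line_digraph G) S m"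
      using white_twins_stay_white[of a b] by blast
    with ab m show False by simp
  qed
  moreover have "fst ` (parcs G - S) \<subseteq> pverts G"
    using in_arcsD1 by auto
  ultimately have "card (parcs G - S) \<le> card (pverts G)"
    using pair_finite_verts by (rule card_inj_on_le)
  moreover have "card (parcs G - S) = card (parcs G) - card S"
    by (rule card_Diff_subset[OF finite_subset[OF S pair_finite_arcs] S])
  ultimately show ?thesis
    by simp
qed

text \<open>
  Here \<open>U\<close> stands for the tails of the arcs that a stalled forcing process has left white. If \<open>U\<close>
  is non-empty, the finite relation \<open>w \<mapsto> f w\<close> on \<open>U\<close> has no minimal element and hence a cycle
  through some \<open>x\<close>. A second out-neighbour of \<open>x\<close> is not in \<open>U\<close>, so it cannot reach \<open>x\<close>, and
  \<open>escape\<close> says that then \<open>f x\<close> cannot reach \<open>x\<close> either.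
\<close>

lemma no_stalled_vertices:
  assumes "finite U"
    and in_nbr: "\<And>v. v \<in> U \<Longrightarrow> \<exists>w. (w, v) \<in> A"
    and two_out_nbrs: "\<And>v. v \<in> U \<Longrightarrow> \<exists>g. (v, g) \<in> A \<and> g \<noteq> f v"
    and f: "\<And>v. v \<in> U \<Longrightarrow> (v, f v) \<in> A"
    and escape: "\<And>v g. \<lbrakk>v \<in> U; (v, g) \<in> A; (g, v) \<notin> A\<^sup>*\<rbrakk> \<Longrightarrow> (f v, v) \<notin> A\<^sup>*"
    and into_U: "\<And>v w. \<lbrakk>v \<in> U; (w, v) \<in> A\<rbrakk> \<Longrightarrow> w \<in> U \<and> v = f w"
  shows "U = {}"
proof (rule ccontr)
  assume "U \<noteq> {}"
  define R where "R = (\<lambda>v. (v, f v)) ` U"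
  have reach: "x \<in> U" if "(x, v) \<in> A\<^sup>*" "v \<in> U" for x v
    using that by (induction rule: converse_rtrancl_induct) (use into_U in blast)+
  have "acyclic R"
  proof (rule acyclicI, intro allI notI)
    fix x
    assume "(x, x) \<in> R\<^sup>+"
    then have x: "x \<in> U" and cycle: "(f x, x) \<in> R\<^sup>*"
      by (auto simp: R_def dest!: tranclD)
    have "R \<subseteq> A"
      using f by (auto simp: R_def)
    with cycle have "(f x, x) \<in> A\<^sup>*"
      using rtrancl_mono by blast
    moreover obtain g where g: "(x, g) \<in> A" "g \<noteq> f x"
      using two_out_nbrs x by blast
    then have "g \<notin> U"
      using into_U by blast
    then have "(g, x) \<notin> A\<^sup>*"
      using reach x by blast
    ultimately show False
      using escape x g by blast
  qed
  then have "wf R"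
    using \<open>finite U\<close> by (simp add: R_def finite_acyclic_wf)
  then obtain v where "v \<in> U" and minimal: "\<And>w. (w, v) \<in> R \<Longrightarrow> w \<notin> U"
    using \<open>U \<noteq> {}\<close> by (metis wf_eq_minimal ex_in_conv)
  then obtain w where "w \<in> U" "v = f w"
    using in_nbr into_U by blast
  with minimal show False
    by (auto simp: R_def)
qed

text \<open>
  The set consists of all arcs except one out-arc \<open>(v, f v)\<close> per vertex. Two out-neighbours per
  vertex make it non-empty and give the second out-neighbour that \<open>no_stalled_vertices\<close> needs.
\<close>

lemma (in pair_fin_digraph) ex_zero_forcing_set_line_digraph:
  assumes "pverts G \<noteq> {}"
    and out: "\<And>v. v \<in> pverts G \<Longrightarrow> card (out_nbrs G v) \<ge> 2"
    and in_nonempty: "\<And>v. v \<in> pverts G \<Longrightarrow> in_nbrs G v \<noteq> {}"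
  shows "\<exists>S. zero_forcing_set (line_digraph G) S \<and> card S + card (pverts G) = card (parcs G)"
proof -
  let ?A = "parcs G"
  have second: "\<exists>g. (v, g) \<in> ?A \<and> g \<noteq> x" if "v \<in> pverts G" for v x
  proof (rule ccontr)
    assume "\<not> ?thesis"
    then have "out_nbrs G v \<subseteq> {x}"
      by (auto simp: out_nbrs_def)
    then have "card (out_nbrs G v) \<le> card {x}"
      by (intro card_mono) auto
    with out[OF that] show False by simp
  qed
  \<comment> \<open>If every out-neighbour of \<open>v\<close> reaches \<open>v\<close>, the second conjunct is vacuous and any choice will do.\<close>
  have "\<exists>y. (v, y) \<in> ?A \<and> (\<forall>g. (v, g) \<in> ?A \<longrightarrow> (g, v) \<notin> ?A\<^sup>* \<longrightarrow> (y, v) \<notin> ?A\<^sup>*)"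
    if "v \<in> pverts G" for v
    using second[OF that] by blast
  then obtain f where f: "\<And>v. v \<in> pverts G \<Longrightarrow> (v, f v) \<in> ?A"
    and escape: "\<And>v g. \<lbrakk>v \<in> pverts G; (v, g) \<in> ?A; (g, v) \<notin> ?A\<^sup>*\<rbrakk> \<Longrightarrow> (f v, v) \<notin> ?A\<^sup>*"
    by metis
  define W where "W = (\<lambda>v. (v, f v)) ` pverts G"
  have W: "W \<subseteq> ?A" "card W = card (pverts G)"
    using f by (auto simp: W_def card_image inj_on_def)
  have "?A - W \<noteq> {}"
  proof -
    from assms(1) obtain v g where "v \<in> pverts G" "(v, g) \<in> ?A" "g \<noteq> f v"
      using second by blast
    then show ?thesis
      by (auto simp: W_def)
  qed
  then have "zero_forcing_set (line_digraph G) (?A - W)"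
  proof (rule zero_forcing_setI[rotated])
    fix B
    assume "?A - W \<subseteq> B" "B \<subseteq> pverts (line_digraph G)"
      and no_force: "\<And>a x. \<lbrakk>a \<in> B; x \<in> pverts (line_digraph G)\<rbrakk>
        \<Longrightarrow> out_nbrs (line_digraph G) a - B \<noteq> {x}"
    then have SB: "?A - W \<subseteq> B" and BA: "B \<subseteq> ?A"
      by auto
    define U where "U = {v \<in> pverts G. (v, f v) \<notin> B}"
    have white: "v \<in> U \<and> x = f v" if "(v, x) \<in> ?A" "(v, x) \<notin> B" for v x
      using that SB by (auto simp: U_def W_def)
    have into_U: "w \<in> U \<and> v = f w" if "v \<in> U" "(w, v) \<in> ?A" for v w
    proof (rule white)
      show "(w, v) \<notin> B"
      proof
        assume "(w, v) \<in> B"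
        moreover have "out_nbrs (line_digraph G) (w, v) - B = {(v, f v)}"
          using that f white by (auto simp: out_nbrs_line_digraph U_def)
        ultimately show False
          using no_force[of "(w, v)" "(v, f v)"] f that by (auto simp: U_def)
      qed
    qed (rule that)
    have "U = {}"
    proof (rule no_stalled_vertices[where A = ?A and f = f])
      show "finite U"
        by (simp add: U_def)
      show "\<exists>w. (w, v) \<in> ?A" if "v \<in> U" for v
        using in_nonempty[of v] that by (auto simp: U_def in_nbrs_def)
      show "\<exists>g. (v, g) \<in> ?A \<and> g \<noteq> f v" if "v \<in> U" for v
        using second that by (simp add: U_def)
      show "(v, f v) \<in> ?A" if "v \<in> U" for v
        using f that by (simp add: U_def)
      show "(f v, v) \<notin> ?A\<^sup>*" if "v \<in> U" "(v, g) \<in> ?A" "(g, v) \<notin> ?A\<^sup>*" for v g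
        using escape[of v g] that by (simp add: U_def)
    qed (rule into_U)
    then show "B = pverts (line_digraph G)"
      using BA white by auto
  qed (use pair_finite_arcs in auto)
  moreover have "card (?A - W) + card W = card ?A"
    using card_Diff_subset[OF finite_subset[OF W(1) pair_finite_arcs] W(1)]
      card_mono[OF pair_finite_arcs W(1)] by simp
  ultimately show ?thesis
    using W(2) by auto
qed

theorem theorem3p8:
  fixes G :: "'a pair_pre_digraph"
  assumes "pair_fin_digraph G"
    and "Digraph_Component.connected (with_proj G)"
    and "min_out_degree G \<ge> 2"
    and "min_in_degree G \<ge> 1"
  shows "int (zero_forcing_number (line_digraph G)) = int (card (parcs G)) - int (card (pverts G))"
proof -
  interpret pair_fin_digraph G by fact
  have nonempty: "pverts G \<noteq> {}"
    using assms(2) by (auto simp: Digraph_Component.connected_def strongly_connected_def)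
  have "card (out_nbrs G v) \<ge> 2" if "v \<in> pverts G" for v
    using assms(3) that nonempty
    by (simp add: min_out_degree_def out_degree_eq_card_out_nbrs)
  moreover have "in_nbrs G v \<noteq> {}" if "v \<in> pverts G" for v
    using assms(4) that nonempty
    by (force simp: min_in_degree_def in_degree_eq_card_in_nbrs)
  ultimately obtain S where S: "zero_forcing_set (line_digraph G) S"
    and card: "card S + card (pverts G) = card (parcs G)"
    using ex_zero_forcing_set_line_digraph nonempty by blast
  have "card S \<le> card T" if "zero_forcing_set (line_digraph G) T" for T
    using card_parcs_le_zero_forcing_set[OF that] card by simp
  with S have "zero_forcing_number (line_digraph G) = card S"
    using pair_finite_arcs by (intro zero_forcing_number_eqI) auto
  with card show ?thesis by simp
qed

end
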